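(* Let $k_\mathcal{G}=n_\mathcal{G}\ge1$ and $k_\mathcal{H}=n_\mathcal{H}-2\ge1$. For $g\in V(\mathcal{G})$ let $s_g=\alpha+\beta\sum_{h\in V(\mathcal{H})}x_{gh}+\gamma\sum_{\{h,h'\}\subseteq V(\mathcal{H})}x_{gh}x_{gh'}$ with $\alpha=(n_\mathcal{H}-2)\big(n_\mathcal{H}+\tfrac12(n_\mathcal{H}-1)\sqrt2\big)$, $\beta=-\big((2n_\mathcal{H}-3)+(n_\mathcal{H}-2)\sqrt2\big)$, $\gamma=2+\sqrt2$. Then these polynomials form a $2$-sum-of-squares certificate of $f_{\mathrm{viz}}$, i.e. $f_{\mathrm{viz}}\equiv\sum_{g\in V(\mathcal{G})}s_g^2\pmod{I_{\mathrm{viz}}}$; consequently $\gamma(G)\gamma(H)\le\gamma(G\Box H)$ for all graphs $G$ on $n_\mathcal{G}$ vertices with domination number $n_\mathcal{G}$ and $H$ on $n_\mathcal{H}$ vertices with domination number $n_\mathcal{H}-2$.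
   Context: $\mathbb{K}$ is a subfield of $\mathbb{R}$ containing $\sqrt2$ (e.g. $\mathbb{K}=\mathbb{R}$). $V(\mathcal{G})$ is a set of $n_\mathcal{G}$ vertices with fixed subset $D_\mathcal{G}$ of size $k_\mathcal{G}$; $V(\mathcal{H})$ a disjoint set of $n_\mathcal{H}$ vertices with fixed subset $D_\mathcal{H}$ of size $k_\mathcal{H}$. Variables $e_{gg'}=e_{g'g}$ for 2-subsets of $V(\mathcal{G})$, $e_{hh'}$ for 2-subsets of $V(\mathcal{H})$, $x_{gh}$ for $g\in V(\mathcal{G}),h\in V(\mathcal{H})$; $P$ is the polynomial ring over $\mathbb{K}$ in these. $I_{\mathrm{viz}}\subseteq P$ is generated by: $e_{gg'}^2-e_{gg'}$; $\prod_{g'\in D_\mathcal{G}}(1-e_{gg'})$ for $g\in V(\mathcal{G})\setminus D_\mathcal{G}$; $\prod_{g'\in V(\mathcal{G})\setminus S}\sum_{g\in S}e_{gg'}$ for $S\subseteq V(\mathcal{G})$, $|S|=k_\mathcal{G}-1$; the same three families for $\mathcal{H}$; $x_{gh}^2-x_{gh}$; and $(1-x_{gh})\prod_{g'\ne g}(1-e_{gg'}x_{g'h})\prod_{h'\ne h}(1-e_{hh'}x_{gh'})$ for all $g,h$. $f_{\mathrm{viz}}=\sum_{g,h}x_{gh}-k_\mathcal{G}k_\mathcal{H}$. $\gamma(\cdot)$ (applied to graphs) is the domination number, $G\Box H$ the Cartesian product graph. An $\ell$-sum-of-squares certificate of $f$ modulo $I$ is a family of polynomials $s_i$ of degree $\le\ell$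 with $f-\sum s_i^2\in I$. *)

theory Defs
  imports
    Complex_Main
    "HOL-Library.Poly_Mapping"
    "HOL-Algebra.Algebraic_Closure_Type"
begin

section \<open>Multivariate polynomials\<close>

text \<open>
  Monomials are finitely supported exponent functions, polynomials are finitely supported
  functions from monomials to real coefficients.
\<close>

type_synonym 'v mpoly = "('v \<Rightarrow>\<^sub>0 nat) \<Rightarrow>\<^sub>0 real"

definition mvar :: "'v \<Rightarrow> 'v mpoly"
  where "mvar v = Poly_Mapping.single (Poly_Mapping.single v 1) 1"

definition mconst :: "real \<Rightarrow> 'v mpoly"
  where "mconst c = Poly_Mapping.single 0 c"

definition monom_degree :: "('v \<Rightarrow>\<^sub>0 nat) \<Rightarrow> nat"
  where "monom_degree m = (\<Sum>v\<in>Poly_Mapping.keys m. Poly_Mapping.lookup m v)"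

text \<open>The zero polynomial gets degree 0.\<close>

definition total_degree :: "'v mpoly \<Rightarrow> nat"
  where "total_degree p = Max (insert 0 (monom_degree ` Poly_Mapping.keys p))"

text \<open>The polynomial ring over a subfield \<open>K\<close> of the reals in the set \<open>W\<close> of variables.\<close>

definition poly_ring_over :: "real set \<Rightarrow> 'v set \<Rightarrow> 'v mpoly ring"
  where "poly_ring_over K W =
    ring_of_type_algebra
      \<lparr>carrier := {p. (\<forall>m. Poly_Mapping.lookup p m \<in> K) \<and>
        (\<forall>m\<in>Poly_Mapping.keys p. Poly_Mapping.keys m \<subseteq> W)}\<rparr>"

definition sos_certificate ::
    "'v mpoly ring \<Rightarrow> 'v mpoly set \<Rightarrow> nat \<Rightarrow> 'v mpoly \<Rightarrow> 'i set \<Rightarrow> ('i \<Rightarrow> 'v mpoly) \<Rightarrow> bool"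
  where "sos_certificate P I l f A s \<longleftrightarrow>
    finite A \<and>
    (\<forall>i\<in>A. s i \<in> carrier P \<and> total_degree (s i) \<le> l) \<and>
    f - (\<Sum>i\<in>A. (s i)\<^sup>2) \<in> I"


section \<open>The Vizing ideal\<close>

text \<open>
  The variable \<open>e\<^sub>g\<^sub>g\<^sub>'\<close> is indexed by the set \<open>{g, g'}\<close>, which makes it symmetric.
  Separate constructors for the two graphs render the disjointness of their vertex sets.
\<close>

datatype ('a, 'b) viz_var = EdgeG "'a set" | EdgeH "'b set" | Vert 'a 'b

definition eG :: "'a \<Rightarrow> 'a \<Rightarrow> ('a, 'b) viz_var mpoly"
  where "eG g g' = mvar (EdgeG {g, g'})"

definition eH :: "'b \<Rightarrow> 'b \<Rightarrow> ('a, 'b) viz_var mpoly"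
  where "eH h h' = mvar (EdgeH {h, h'})"

definition xv :: "'a \<Rightarrow> 'b \<Rightarrow> ('a, 'b) viz_var mpoly"
  where "xv g h = mvar (Vert g h)"

definition viz_vars :: "'a set \<Rightarrow> 'b set \<Rightarrow> ('a, 'b) viz_var set"
  where "viz_vars VG VH =
    EdgeG ` {e. e \<subseteq> VG \<and> card e = 2} \<union>
    EdgeH ` {e. e \<subseteq> VH \<and> card e = 2} \<union>
    {Vert g h | g h. g \<in> VG \<and> h \<in> VH}"

definition viz_ring :: "real set \<Rightarrow> 'a set \<Rightarrow> 'b set \<Rightarrow> ('a, 'b) viz_var mpoly ring"
  where "viz_ring K VG VH = poly_ring_over K (viz_vars VG VH)"

text \<open>
  The generators describing a graph on \<open>V\<close> with minimum dominating set \<open>D\<close> of size \<open>k\<close>,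
  where \<open>e v w\<close> is the edge variable of \<open>{v, w}\<close>.
\<close>

definition graph_generators ::
    "('c \<Rightarrow> 'c \<Rightarrow> 'v mpoly) \<Rightarrow> 'c set \<Rightarrow> 'c set \<Rightarrow> nat \<Rightarrow> 'v mpoly set"
  where "graph_generators e V D k =
    {(e v w)\<^sup>2 - e v w | v w. v \<in> V \<and> w \<in> V \<and> v \<noteq> w} \<union>
    {\<Prod>w\<in>D. (1 - e v w) | v. v \<in> V - D} \<union>
    {\<Prod>w\<in>V - S. \<Sum>v\<in>S. e v w | S. S \<subseteq> V \<and> card S = k - 1}"

definition product_generators :: "'a set \<Rightarrow> 'b set \<Rightarrow> ('a, 'b) viz_var mpoly set"
  where "product_generators VG VH =
    {(xv g h)\<^sup>2 - xv g h | g h. g \<in> VG \<and> h \<in> VH} \<union>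
    {(1 - xv g h) * (\<Prod>g'\<in>VG - {g}. (1 - eG g g' * xv g' h))
                  * (\<Prod>h'\<in>VH - {h}. (1 - eH h h' * xv g h')) | g h. g \<in> VG \<and> h \<in> VH}"

definition viz_generators ::
    "'a set \<Rightarrow> 'a set \<Rightarrow> nat \<Rightarrow> 'b set \<Rightarrow> 'b set \<Rightarrow> nat \<Rightarrow> ('a, 'b) viz_var mpoly set"
  where "viz_generators VG DG kG VH DH kH =
    graph_generators eG VG DG kG \<union> graph_generators eH VH DH kH \<union> product_generators VG VH"

definition viz_ideal ::
    "real set \<Rightarrow> 'a set \<Rightarrow> 'a set \<Rightarrow> nat \<Rightarrow> 'b set \<Rightarrow> 'b set \<Rightarrow> nat \<Rightarrow> ('a, 'b) viz_var mpoly set"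
  where "viz_ideal K VG DG kG VH DH kH =
    Idl\<^bsub>viz_ring K VG VH\<^esub> (viz_generators VG DG kG VH DH kH)"

definition viz_poly :: "'a set \<Rightarrow> nat \<Rightarrow> 'b set \<Rightarrow> nat \<Rightarrow> ('a, 'b) viz_var mpoly"
  where "viz_poly VG kG VH kH = (\<Sum>g\<in>VG. \<Sum>h\<in>VH. xv g h) - of_nat (kG * kH)"


section \<open>The polynomial ring is a ring containing the generators\<close>

text \<open>
  \<open>genideal\<close> is only meaningful over a ring that contains the generating set; the following
  facts ensure this.
\<close>

lemma subfield_realD:
  assumes "subfield K (ring_of_type_algebra :: real ring)"
  shows "0 \<in> K" "1 \<in> K"
    and "x \<in> K \<Longrightarrow> y \<in> K \<Longrightarrow> x + y \<in> K"
    and "x \<in> K \<Longrightarrow> y \<in> K \<Longrightarrow> x * y \<in> K"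
    and "x \<in> K \<Longrightarrow> - x \<in> K"
proof -
  interpret R: ring "ring_of_type_algebra :: real ring" by (rule ring_from_type_algebra)
  have sr: "subring K (ring_of_type_algebra :: real ring)"
    using assms subfield.axioms(1) subdomain.axioms(1) subcring.axioms(1) by blast
  show "0 \<in> K" "1 \<in> K"
    using subringE(2,3)[OF sr] by (simp_all add: ring_of_type_algebra_def)
  show "x \<in> K \<Longrightarrow> y \<in> K \<Longrightarrow> x + y \<in> K" "x \<in> K \<Longrightarrow> y \<in> K \<Longrightarrow> x * y \<in> K"
    using subringE(6,7)[OF sr, of x y] by (simp_all add: ring_of_type_algebra_def)
  show "- x \<in> K" if "x \<in> K"
  proof -
    have "\<ominus>\<^bsub>ring_of_type_algebra\<^esub> x \<in> K" using subringE(5)[OF sr that] .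
    moreover have "\<ominus>\<^bsub>ring_of_type_algebra\<^esub> x = - x"
      by (rule R.minus_equality) (simp_all add: ring_of_type_algebra_def)
    ultimately show ?thesis by simp
  qed
qed

context
  fixes K :: "real set" and W :: "'v set"
  assumes K: "subfield K (ring_of_type_algebra :: real ring)"
begin

lemma carrier_iff:
  "p \<in> carrier (poly_ring_over K W) \<longleftrightarrow>
    (\<forall>m. Poly_Mapping.lookup p m \<in> K) \<and>
    (\<forall>m\<in>Poly_Mapping.keys p. Poly_Mapping.keys m \<subseteq> W)"
  by (simp add: poly_ring_over_def)

lemma carrier_single:
  assumes "c \<in> K" "Poly_Mapping.keys m \<subseteq> W"
  shows "Poly_Mapping.single m c \<in> carrier (poly_ring_over K W)"
  using assms subfield_realD(1)[OF K]
  by (auto simp: carrier_iff lookup_single when_def)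

lemma carrier_add:
  assumes "p \<in> carrier (poly_ring_over K W)" "q \<in> carrier (poly_ring_over K W)"
  shows "p + q \<in> carrier (poly_ring_over K W)"
  using assms keys_add[of p q] subfield_realD(3)[OF K]
  by (fastforce simp: carrier_iff lookup_add)

lemma carrier_uminus:
  assumes "p \<in> carrier (poly_ring_over K W)"
  shows "- p \<in> carrier (poly_ring_over K W)"
  using assms subfield_realD(5)[OF K]
  by (auto simp: carrier_iff in_keys_iff)

lemma carrier_diff:
  assumes "p \<in> carrier (poly_ring_over K W)" "q \<in> carrier (poly_ring_over K W)"
  shows "p - q \<in> carrier (poly_ring_over K W)"
  using carrier_add[OF assms(1) carrier_uminus[OF assms(2)]] by simp

lemma carrier_0: "0 \<in> carrier (poly_ring_over K W)"
  using subfield_realD(1)[OF K] by (simp add: carrier_iff)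

lemma carrier_const: "c \<in> K \<Longrightarrow> mconst c \<in> carrier (poly_ring_over K W)"
  by (simp add: mconst_def carrier_single)

lemma carrier_1: "1 \<in> carrier (poly_ring_over K W)"
  using carrier_single[of 1 0] subfield_realD(2)[OF K] by simp

lemma carrier_var: "v \<in> W \<Longrightarrow> mvar v \<in> carrier (poly_ring_over K W)"
  by (simp add: mvar_def carrier_single subfield_realD(2)[OF K])

lemma carrier_sum:
  assumes "\<And>i. i \<in> A \<Longrightarrow> f i \<in> carrier (poly_ring_over K W)"
  shows "sum f A \<in> carrier (poly_ring_over K W)"
  using assms by (induction A rule: infinite_finite_induct) (auto intro: carrier_0 carrier_add)

lemma carrier_mult:
  assumes "p \<in> carrier (poly_ring_over K W)" "q \<in> carrier (poly_ring_over K W)"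
  shows "p * q \<in> carrier (poly_ring_over K W)"
proof -
  have expand: "r = (\<Sum>m\<in>Poly_Mapping.keys r. Poly_Mapping.single m (Poly_Mapping.lookup r m))"
    for r :: "'v mpoly"
  proof (rule poly_mapping_eqI)
    fix x
    have "Poly_Mapping.lookup (\<Sum>m\<in>Poly_Mapping.keys r.
        Poly_Mapping.single m (Poly_Mapping.lookup r m)) x =
      (\<Sum>m\<in>Poly_Mapping.keys r. if m = x then Poly_Mapping.lookup r m else 0)"
      unfolding lookup_sum by (intro sum.cong refl) (simp add: lookup_single when_def)
    also have "\<dots> = Poly_Mapping.lookup r x"
      by (simp add: sum.delta' in_keys_iff)
    finally show "Poly_Mapping.lookup r x = Poly_Mapping.lookup (\<Sum>m\<in>Poly_Mapping.keys r.
        Poly_Mapping.single m (Poly_Mapping.lookup r m)) x" ..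
  qed
  have "p * q = (\<Sum>m\<in>Poly_Mapping.keys p. Poly_Mapping.single m (Poly_Mapping.lookup p m)) *
      (\<Sum>n\<in>Poly_Mapping.keys q. Poly_Mapping.single n (Poly_Mapping.lookup q n))"
    by (rule arg_cong2[OF expand expand])
  also have "\<dots> = (\<Sum>m\<in>Poly_Mapping.keys p. \<Sum>n\<in>Poly_Mapping.keys q.
      Poly_Mapping.single (m + n) (Poly_Mapping.lookup p m * Poly_Mapping.lookup q n))"
    by (simp only: sum_product mult_single)
  finally have pq: "p * q = \<dots>" .
  have "Poly_Mapping.single (m + n) (Poly_Mapping.lookup p m * Poly_Mapping.lookup q n)
      \<in> carrier (poly_ring_over K W)"
    if "m \<in> Poly_Mapping.keys p" "n \<in> Poly_Mapping.keys q" for m n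
  proof (rule carrier_single)
    show "Poly_Mapping.lookup p m * Poly_Mapping.lookup q n \<in> K"
      using assms subfield_realD(4)[OF K] by (simp add: carrier_iff)
    have "Poly_Mapping.keys m \<subseteq> W" "Poly_Mapping.keys n \<subseteq> W"
      using assms that by (simp_all add: carrier_iff)
    then show "Poly_Mapping.keys (m + n) \<subseteq> W"
      using keys_add[of m n] by blast
  qed
  then show ?thesis
    unfolding pq by (intro carrier_sum) blast
qed

lemma carrier_prod:
  assumes "\<And>i. i \<in> A \<Longrightarrow> f i \<in> carrier (poly_ring_over K W)"
  shows "prod f A \<in> carrier (poly_ring_over K W)"
  using assms by (induction A rule: infinite_finite_induct) (auto intro: carrier_1 carrier_mult)

lemma cring_poly_ring_over: "cring (poly_ring_over K W)"
proof -
  note closed = carrier_0 carrier_1 carrier_add carrier_mult carrier_uminus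
  note ops = poly_ring_over_def ring_of_type_algebra_def
  have ops': "monoid.mult (poly_ring_over K W) = (*)" "add (poly_ring_over K W) = (+)"
      "one (poly_ring_over K W) = 1" "zero (poly_ring_over K W) = 0"
    by (auto simp: ops)
  show ?thesis
  proof (rule cringI)
    show "abelian_group (poly_ring_over K W)"
    proof (rule abelian_groupI)
      fix x assume "x \<in> carrier (poly_ring_over K W)"
      then show "\<exists>y\<in>carrier (poly_ring_over K W).
          y \<oplus>\<^bsub>poly_ring_over K W\<^esub> x = \<zero>\<^bsub>poly_ring_over K W\<^esub>"
        by (intro bexI[of _ "- x"]) (auto simp: ops' intro: closed)
    qed (auto simp: ops' algebra_simps intro: closed)
    show "comm_monoid (poly_ring_over K W)"
      by (rule comm_monoidI) (auto simp: ops' algebra_simps intro: closed)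
  qed (auto simp: ops' algebra_simps)
qed

end

lemma viz_generators_carrier:
  assumes K: "subfield K (ring_of_type_algebra :: real ring)"
    and "DG \<subseteq> VG" "DH \<subseteq> VH"
  shows "viz_generators VG DG kG VH DH kH \<subseteq> carrier (viz_ring K VG VH)"
proof -
  let ?C = "carrier (viz_ring K VG VH)"
  note closed = carrier_add[OF K] carrier_diff[OF K] carrier_mult[OF K] carrier_1[OF K]
    carrier_sum[OF K] carrier_prod[OF K]
  have x: "xv g h \<in> ?C" if "g \<in> VG" "h \<in> VH" for g h
    using that unfolding viz_ring_def xv_def by (intro carrier_var[OF K]) (auto simp: viz_vars_def)
  have eG: "eG g g' \<in> ?C" if "g \<in> VG" "g' \<in> VG" "g \<noteq> g'" for g g'
    using that unfolding viz_ring_def eG_def by (intro carrier_var[OF K]) (auto simp: viz_vars_def)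
  have eH: "eH h h' \<in> ?C" if "h \<in> VH" "h' \<in> VH" "h \<noteq> h'" for h h'
    using that unfolding viz_ring_def eH_def by (intro carrier_var[OF K]) (auto simp: viz_vars_def)
  have gen: "graph_generators e V D k \<subseteq> ?C"
    if e: "\<And>v w. v \<in> V \<Longrightarrow> w \<in> V \<Longrightarrow> v \<noteq> w \<Longrightarrow> e v w \<in> ?C" and D: "D \<subseteq> V"
    for e :: "'c \<Rightarrow> 'c \<Rightarrow> ('a, 'b) viz_var mpoly" and V D k
  proof -
    have "(e v w)\<^sup>2 - e v w \<in> ?C" if "v \<in> V" "w \<in> V" "v \<noteq> w" for v w
      using e[OF that] unfolding power2_eq_square viz_ring_def by (intro closed)
    moreover have "(\<Prod>w\<in>D. (1 - e v w)) \<in> ?C" if "v \<in> V - D" for v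
      using e that D unfolding viz_ring_def by (intro closed) auto
    moreover have "(\<Prod>w\<in>V - S. \<Sum>v\<in>S. e v w) \<in> ?C" if "S \<subseteq> V" for S
      using e that unfolding viz_ring_def by (intro closed) auto
    ultimately show ?thesis
      unfolding graph_generators_def by blast
  qed
  have "product_generators VG VH \<subseteq> ?C"
    using x eG eH unfolding product_generators_def viz_ring_def power2_eq_square
    by (auto intro!: closed)
  with gen[OF eG assms(2)] gen[OF eH assms(3)] show ?thesis
    unfolding viz_generators_def by auto
qed


section \<open>Graphs\<close>

text \<open>A finite simple graph is given by its vertex set and its set of edges (2-subsets).\<close>

definition simple_graph :: "'v set \<Rightarrow> 'v set set \<Rightarrow> bool"
  where "simple_graph V E \<longleftrightarrow> finite V \<and> E \<subseteq> {e. e \<subseteq> V \<and> card e = 2}"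

definition dominating_set :: "'v set \<Rightarrow> 'v set set \<Rightarrow> 'v set \<Rightarrow> bool"
  where "dominating_set V E D \<longleftrightarrow> D \<subseteq> V \<and> (\<forall>v\<in>V - D. \<exists>d\<in>D. {v, d} \<in> E)"

definition domination_number :: "'v set \<Rightarrow> 'v set set \<Rightarrow> nat"
  where "domination_number V E = Min (card ` {D. dominating_set V E D})"

definition box_edges :: "'a set \<Rightarrow> 'a set set \<Rightarrow> 'b set \<Rightarrow> 'b set set \<Rightarrow> ('a \<times> 'b) set set"
  where "box_edges VG EG VH EH =
    {{(g, h), (g, h')} | g h h'. g \<in> VG \<and> {h, h'} \<in> EH} \<union>
    {{(g, h), (g', h)} | g g' h. {g, g'} \<in> EG \<and> h \<in> VH}"

end

theory Submission
  imports Defs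
begin

text \<open>
  Modulo an ideal that contains \<open>v\<^sup>2 - v\<close> for every variable \<open>v\<close>, any \<open>q\<close> splits as
  \<open>q v + q (1 - v)\<close>. Hence an element \<open>p\<close> outside of the ideal stays outside of one of the two
  colon ideals by \<open>v\<close> and by \<open>1 - v\<close>; repeating this for all variables gives an ideal modulo
  which every variable, and so every polynomial, is a constant. It therefore suffices to check
  that \<open>f\<^bsub>viz\<^esub> - \<Sum> s\<^sub>g\<^sup>2\<close> vanishes at the 0/1 points that are zeros of all generators. There \<open>\<G>\<close> has no
  edges, so that each fibre \<open>{h. x\<^sub>g\<^sub>h = 1}\<close> dominates \<open>\<H>\<close> and has \<open>n\<^sub>\<H> - 2\<close>, \<open>n\<^sub>\<H> - 1\<close> or \<open>n\<^sub>\<H>\<close>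
  elements; \<open>s\<^sub>g\<close> takes the values \<open>0\<close>, \<open>-1\<close>, \<open>sqrt 2\<close> in these three cases.
\<close>

section \<open>Degrees\<close>

lemma monom_degree_eq_sum:
  assumes "finite A" "Poly_Mapping.keys m \<subseteq> A"
  shows "monom_degree m = (\<Sum>v\<in>A. Poly_Mapping.lookup m v)"
  unfolding monom_degree_def using assms
  by (intro sum.mono_neutral_left) (auto simp: in_keys_iff)

lemma monom_degree_add: "monom_degree (m + n) = monom_degree m + monom_degree n"
proof -
  let ?A = "Poly_Mapping.keys m \<union> Poly_Mapping.keys n"
  have "monom_degree k = (\<Sum>v\<in>?A. Poly_Mapping.lookup k v)" if "k \<in> {m, n, m + n}" for k
    using that keys_add[of m n] by (intro monom_degree_eq_sum) auto
  then show ?thesis by (simp add: lookup_add sum.distrib)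
qed

text \<open>The \<open>insert 0\<close> in the degree gives the zero polynomial a maximum and adds
  no constraint to an upper bound in the naturals. Degree bounds can thus be checked monomial by
  monomial.\<close>

lemma total_degree_le_iff:
  "total_degree p \<le> l \<longleftrightarrow> (\<forall>m\<in>Poly_Mapping.keys p. monom_degree m \<le> l)"
  by (simp add: total_degree_def)

lemma total_degree_add_le: "total_degree p \<le> l \<Longrightarrow> total_degree q \<le> l \<Longrightarrow> total_degree (p + q) \<le> l"
  using keys_add[of p q] by (auto simp: total_degree_le_iff)

lemma total_degree_sum_le:
  "(\<And>i. i \<in> A \<Longrightarrow> total_degree (f i) \<le> l) \<Longrightarrow> total_degree (sum f A) \<le> l"
proof (induction A rule: infinite_finite_induct)
  case (insert x F)
  then show ?case by (simp add: total_degree_add_le)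
qed (simp_all add: total_degree_le_iff)

lemma total_degree_mult_le:
  assumes "total_degree p \<le> k" "total_degree q \<le> l"
  shows "total_degree (p * q) \<le> k + l"
  unfolding total_degree_le_iff
proof
  fix m assume "m \<in> Poly_Mapping.keys (p * q)"
  then obtain a b where "m = a + b" "a \<in> Poly_Mapping.keys p" "b \<in> Poly_Mapping.keys q"
    using keys_mult[of p q] by blast
  then show "monom_degree m \<le> k + l"
    using assms by (auto simp: total_degree_le_iff monom_degree_add intro!: add_mono)
qed

lemma total_degree_mconst: "total_degree (mconst c) = 0"
  by (simp add: total_degree_def mconst_def monom_degree_def)

lemma total_degree_mvar: "total_degree (mvar v) = 1"
  by (simp add: total_degree_def mvar_def monom_degree_def)

lemma total_degree_1: "total_degree 1 = 0"
  by (simp add: total_degree_def monom_degree_def)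

text \<open>An infinite \<open>A\<close> is no exception: its product is 1 and its cardinality
  0.\<close>

lemma total_degree_prod_le:
  "(\<And>i. i \<in> A \<Longrightarrow> total_degree (f i) \<le> 1) \<Longrightarrow> total_degree (prod f A) \<le> card A"
proof (induction A rule: infinite_finite_induct)
  case (insert x F)
  then show ?case using total_degree_mult_le[of "f x" 1 "prod f F" "card F"] by simp
qed (simp_all add: total_degree_1)

section \<open>Ideals containing the Boolean relations\<close>

lemma mconst_add: "mconst (c + d) = mconst c + mconst d"
  by (simp add: mconst_def single_add)

lemma mconst_diff: "mconst (c - d) = mconst c - mconst d"
  by (simp add: mconst_def single_diff)

lemma mconst_mult: "mconst (c * d) = mconst c * mconst d"
  by (simp add: mconst_def mult_single)

lemma mconst_0: "mconst 0 = 0"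
  by (simp add: mconst_def)

lemma mconst_1: "mconst 1 = 1"
  by (simp add: mconst_def)

lemma mconst_of_nat: "mconst (of_nat n) = of_nat n"
  by (induction n) (simp_all add: mconst_add mconst_0 mconst_1)

section \<open>Ideals of the polynomial ring, and constants in the subfield\<close>

lemma poly_ring_over_ops:
  "monoid.mult (poly_ring_over K W) = (*)" "add (poly_ring_over K W) = (+)"
  "one (poly_ring_over K W) = 1" "zero (poly_ring_over K W) = 0"
  by (auto simp: poly_ring_over_def ring_of_type_algebra_def)

text \<open>This replaces the record operations of the ring by those of the type, so that ideal
  membership can be handled with ordinary algebra. Negatives come for free because -1 lies in the
  ring.\<close>

lemma ideal_poly_ring_iff:
  assumes K: "subfield K (ring_of_type_algebra :: real ring)"
  shows "ideal J (poly_ring_over K W) \<longleftrightarrow>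
    J \<subseteq> carrier (poly_ring_over K W) \<and> 0 \<in> J \<and> (\<forall>p\<in>J. \<forall>q\<in>J. p + q \<in> J) \<and>
    (\<forall>p\<in>J. \<forall>q\<in>carrier (poly_ring_over K W). q * p \<in> J)" (is "?l \<longleftrightarrow> ?r")
proof
  assume ?l
  then interpret J: ideal J "poly_ring_over K W" .
  note sub = J.additive_subgroup_axioms
  show ?r
    using J.a_subset additive_subgroup.zero_closed[OF sub] additive_subgroup.a_closed[OF sub]
      J.I_l_closed
    unfolding poly_ring_over_ops by (intro conjI ballI)
next
  assume r: ?r
  interpret R: cring "poly_ring_over K W" by (rule cring_poly_ring_over[OF K])
  have minus: "\<ominus>\<^bsub>poly_ring_over K W\<^esub> p = - p" if "p \<in> carrier (poly_ring_over K W)" for p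
    using that carrier_uminus[OF K that]
    by (intro R.minus_equality) (simp_all add: poly_ring_over_ops)
  have "- p \<in> J" if "p \<in> J" for p
  proof -
    have "- 1 * p \<in> J" using r that carrier_uminus[OF K carrier_1[OF K]] by blast
    then show ?thesis by simp
  qed
  then have "\<ominus>\<^bsub>poly_ring_over K W\<^esub> p \<in> J" if "p \<in> J" for p
    using that r minus by (metis subsetD)
  then have "subgroup J (add_monoid (poly_ring_over K W))"
    using r R.add.subgroupI[of J] by (auto simp: poly_ring_over_ops a_inv_def)
  then show ?l
    using r by (intro idealI R.ring_axioms) (auto simp: poly_ring_over_ops mult.commute)
qed

lemma subfield_real_inverse:
  assumes K: "subfield K (ring_of_type_algebra :: real ring)" and "x \<in> K"
  shows "inverse x \<in> K"
proof (cases "x = 0")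
  case True
  then show ?thesis using assms by simp
next
  case False
  interpret R: ring "ring_of_type_algebra :: real ring" by (rule ring_from_type_algebra)
  have 1: "x \<in> K - {\<zero>\<^bsub>ring_of_type_algebra\<^esub>}"
    using False assms by (simp add: ring_of_type_algebra_def)
  have "inv\<^bsub>ring_of_type_algebra\<^esub> x \<in> K"
    "x \<otimes>\<^bsub>ring_of_type_algebra\<^esub> inv\<^bsub>ring_of_type_algebra\<^esub> x = \<one>\<^bsub>ring_of_type_algebra\<^esub>"
    using R.subfield_m_inv[OF K 1] by auto
  then show ?thesis
    by (metis (no_types, lifting) inverse_unique monoid.select_convs(1,2) ring_of_type_algebra_def)
qed

lemma subfield_real_of_nat:
  assumes K: "subfield K (ring_of_type_algebra :: real ring)"
  shows "of_nat n \<in> K"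
  by (induction n) (simp_all add: subfield_realD[OF K])

text \<open>A locale, because the argument moves between several ideals over the same ring: the
  Vizing ideal, the colon ideals built from it, and the final ideal modulo which all variables are
  constants.\<close>

locale poly_ideal =
  fixes K :: "real set" and W :: "'v set" and J :: "'v mpoly set"
  assumes K: "subfield K (ring_of_type_algebra :: real ring)"
    and ideal: "ideal J (poly_ring_over K W)"
begin

abbreviation "P \<equiv> carrier (poly_ring_over K W)"

lemma mem_carrier: "p \<in> J \<Longrightarrow> p \<in> P"
  and zero_mem: "0 \<in> J"
  and add_mem: "p \<in> J \<Longrightarrow> q \<in> J \<Longrightarrow> p + q \<in> J"
  and mult_mem: "q \<in> P \<Longrightarrow> p \<in> J \<Longrightarrow> q * p \<in> J"
  using ideal unfolding ideal_poly_ring_iff[OF K] by auto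

lemma uminus_mem: "p \<in> J \<Longrightarrow> - p \<in> J"
  using mult_mem[OF carrier_uminus[OF K carrier_1[OF K]], of p] by simp

lemma diff_mem: "p \<in> J \<Longrightarrow> q \<in> J \<Longrightarrow> p - q \<in> J"
  using add_mem[OF _ uminus_mem, of p q] by simp

lemma colon_poly_ideal:
  assumes "v \<in> P"
  shows "poly_ideal K W {q \<in> P. q * v \<in> J}"
proof (rule poly_ideal.intro)
  show "ideal {q \<in> P. q * v \<in> J} (poly_ring_over K W)"
    unfolding ideal_poly_ring_iff[OF K]
    using carrier_0[OF K] carrier_add[OF K] carrier_mult[OF K] zero_mem add_mem mult_mem
    by (auto simp: distrib_right mult.assoc)
qed (rule K)

text \<open>The two membership conditions make the relation multiplicative: an element of the ideal
  may only be multiplied by elements of the ring, and \<open>mconst c\<close> is one only for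
  \<open>c\<close> in \<open>K\<close>. The constant plays the role of the value of \<open>p\<close>
  at a point.\<close>

definition cong_const :: "'v mpoly \<Rightarrow> real \<Rightarrow> bool"
  where "cong_const p c \<longleftrightarrow> p \<in> P \<and> c \<in> K \<and> p - mconst c \<in> J"

lemma cong_const_mconst: "c \<in> K \<Longrightarrow> cong_const (mconst c) c"
  by (simp add: cong_const_def carrier_const[OF K] zero_mem)

lemma cong_const_0: "cong_const 0 0"
  using cong_const_mconst[of 0] by (simp add: mconst_0 subfield_realD(1)[OF K])

lemma cong_const_1: "cong_const 1 1"
  using cong_const_mconst[of 1] by (simp add: mconst_1 subfield_realD(2)[OF K])

lemma cong_const_add:
  assumes "cong_const p c" "cong_const q d"
  shows "cong_const (p + q) (c + d)"
proof -
  have "(p - mconst c) + (q - mconst d) \<in> J"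
    using assms by (intro add_mem) (auto simp: cong_const_def)
  also have "(p - mconst c) + (q - mconst d) = p + q - mconst (c + d)"
    by (simp add: mconst_add)
  finally show ?thesis
    using assms by (auto simp: cong_const_def carrier_add[OF K] subfield_realD(3)[OF K])
qed

lemma cong_const_mult:
  assumes "cong_const p c" "cong_const q d"
  shows "cong_const (p * q) (c * d)"
proof -
  have "q * (p - mconst c) + mconst c * (q - mconst d) \<in> J"
    using assms by (intro add_mem mult_mem) (auto simp: cong_const_def carrier_const[OF K])
  also have "q * (p - mconst c) + mconst c * (q - mconst d) = p * q - mconst (c * d)"
    by (simp add: mconst_mult algebra_simps)
  finally show ?thesis
    using assms by (auto simp: cong_const_def carrier_mult[OF K] subfield_realD(4)[OF K])
qed

lemma cong_const_diff:
  assumes "cong_const p c" "cong_const q d"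
  shows "cong_const (p - q) (c - d)"
proof -
  have "- 1 \<in> K" using subfield_realD(2,5)[OF K] by blast
  then have "cong_const (mconst (- 1) * q) (- 1 * d)"
    using assms by (intro cong_const_mult cong_const_mconst)
  moreover have "mconst (- 1) = (- 1 :: 'v mpoly)"
    using mconst_diff[of 0 1] by (simp add: mconst_0 mconst_1)
  ultimately show ?thesis
    using cong_const_add[OF assms(1), of "- q" "- d"] by simp
qed

lemma cong_const_sum: "(\<And>i. i \<in> A \<Longrightarrow> cong_const (f i) (c i)) \<Longrightarrow> cong_const (sum f A) (sum c A)"
  by (induction A rule: infinite_finite_induct) (auto intro: cong_const_0 cong_const_add)

lemma cong_const_prod: "(\<And>i. i \<in> A \<Longrightarrow> cong_const (f i) (c i)) \<Longrightarrow> cong_const (prod f A) (prod c A)"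
  by (induction A rule: infinite_finite_induct) (auto intro: cong_const_1 cong_const_mult)

text \<open>Otherwise the nonzero constant \<open>c\<close> would itself lie in \<open>J\<close>;
  its inverse lies in \<open>K\<close>, so \<open>J\<close> would contain 1.\<close>

lemma cong_const_eq_0:
  assumes "cong_const p c" "p \<in> J" "1 \<notin> J"
  shows "c = 0"
proof (rule ccontr)
  assume "c \<noteq> 0"
  have c: "c \<in> K" and "p - mconst c \<in> J" using assms by (auto simp: cong_const_def)
  then have "p - (p - mconst c) \<in> J" using assms by (blast intro: diff_mem)
  then have "mconst (inverse c) * mconst c \<in> J"
    using mult_mem[OF carrier_const[OF K subfield_real_inverse[OF K c]], of "mconst c"] by simp
  with \<open>c \<noteq> 0\<close> assms show False by (simp flip: mconst_mult add: mconst_1)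
qed

lemma cong_const_0_mem: "cong_const p 0 \<Longrightarrow> p \<in> J"
  by (simp add: cong_const_def mconst_0)

text \<open>Passing to a colon ideal only enlarges the ideal, so the alternatives settled for
  earlier elements and the relation for the next \<open>v\<close> survive each step. Only the
  exclusion of \<open>p\<close> is at stake.\<close>

lemma exists_boolean_ideal:
  assumes "finite A" "A \<subseteq> P" "\<And>v. v \<in> A \<Longrightarrow> v\<^sup>2 - v \<in> J" "p \<in> P" "p \<notin> J"
  shows "\<exists>J'. poly_ideal K W J' \<and> J \<subseteq> J' \<and> p \<notin> J' \<and> (\<forall>v\<in>A. v \<in> J' \<or> v - 1 \<in> J')"
  using assms
proof (induction A rule: finite_induct)
  case empty
  then show ?case using poly_ideal_axioms by auto
next
  case (insert v A)
  then obtain J' where "poly_ideal K W J'" and J': "J \<subseteq> J'" "p \<notin> J'"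
    and A: "\<forall>v\<in>A. v \<in> J' \<or> v - 1 \<in> J'" by auto
  interpret J': poly_ideal K W J' by fact
  have v: "v \<in> P" "v\<^sup>2 - v \<in> J'" using insert J' by auto
  then have v1: "v - 1 \<in> P" using carrier_diff[OF K _ carrier_1[OF K]] by blast
  have colon: "poly_ideal K W {q \<in> P. q * w \<in> J'}" "J' \<subseteq> {q \<in> P. q * w \<in> J'}" if "w \<in> P" for w
    using J'.colon_poly_ideal[OF that] J'.mem_carrier J'.mult_mem[OF that]
    by (auto simp: mult.commute[of _ w])
  have v_mem: "v * (v - 1) \<in> J'" using v by (simp add: power2_eq_square algebra_simps)
  \<comment> \<open>If \<open>p * v\<close> is outside \<open>J'\<close>, take the colon ideal by
    \<open>v\<close>: it omits \<open>p\<close> and, by \<open>v_mem\<close>, contains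
    \<open>v - 1\<close>. Otherwise take the colon ideal by \<open>v - 1\<close>, which contains
    \<open>v\<close>; it omits \<open>p\<close> since \<open>p\<close> is the difference of
    \<open>p * v\<close> and \<open>p * (v - 1)\<close>.\<close>
  show ?case
  proof (cases "p * v \<in> J'")
    case False
    have "v - 1 \<in> {q \<in> P. q * v \<in> J'}" using v_mem v1 by (simp add: mult.commute)
    then show ?thesis using False J' A colon[OF v(1)]
      by (intro exI[of _ "{q \<in> P. q * v \<in> J'}"]) blast
  next
    case True
    have "p * (v - 1) \<notin> J'"
    proof
      assume "p * (v - 1) \<in> J'"
      then have "p * v - p * (v - 1) \<in> J'" using True by (intro J'.diff_mem)
      then show False using J' by (simp add: algebra_simps)
    qed
    moreover have "v \<in> {q \<in> P. q * (v - 1) \<in> J'}" using v_mem v by simp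
    ultimately show ?thesis using J' A colon[OF v1]
      by (intro exI[of _ "{q \<in> P. q * (v - 1) \<in> J'}"]) blast
  qed
qed

text \<open>The values are 0 or 1 even outside \<open>W\<close>. Later uses on indices such as
  \<open>EdgeH {h, h}\<close>, which are no variables of the ring, therefore need no side
  condition.\<close>

lemma boolean_values:
  assumes "\<And>v. v \<in> W \<Longrightarrow> mvar v \<in> J \<or> mvar v - 1 \<in> J"
  obtains a where "\<And>v. a v \<in> {0, 1}" "\<And>v. v \<in> W \<Longrightarrow> cong_const (mvar v) (a v)"
proof
  let ?a = "\<lambda>v. if mvar v \<in> J then 0 else 1 :: real"
  show "?a v \<in> {0, 1}" for v by simp
  show "cong_const (mvar v) (?a v)" if "v \<in> W" for v
    using assms[OF that] carrier_var[OF K that] subfield_realD(1,2)[OF K]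
    by (auto simp: cong_const_def mconst_0 mconst_1)
qed

end

section \<open>The values of the certificate\<close>

text \<open>A set of fewer than \<open>k\<close> ones could be enlarged to a set \<open>S\<close> of
  size \<open>k - 1\<close>. The relation for \<open>S\<close> gives a vertex outside
  \<open>S\<close> without neighbours in \<open>S\<close>, whereas the domination relation gives
  that vertex a neighbour among the ones.\<close>

lemma viz_values_fibre_card:
  fixes \<eta> :: "'b \<Rightarrow> 'b \<Rightarrow> real" and \<xi> :: "'b \<Rightarrow> real"
  assumes VH: "finite VH" "k \<ge> 1" "k \<le> card VH"
    and bool: "\<And>h h'. \<eta> h h' \<in> {0, 1}" "\<And>h. \<xi> h \<in> {0, 1}"
    and sym: "\<And>h h'. \<eta> h h' = \<eta> h' h"
    and dom: "\<And>h. h \<in> VH \<Longrightarrow> (1 - \<xi> h) * (\<Prod>h'\<in>VH - {h}. 1 - \<eta> h h' * \<xi> h') = 0"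
    and min: "\<And>S. S \<subseteq> VH \<Longrightarrow> card S = k - 1 \<Longrightarrow> (\<Prod>w\<in>VH - S. \<Sum>v\<in>S. \<eta> v w) = 0"
  shows "k \<le> card {h \<in> VH. \<xi> h = 1}"
proof (rule ccontr)
  let ?T = "{h \<in> VH. \<xi> h = 1}"
  assume "\<not> k \<le> card ?T"
  then have "card ?T \<le> k - 1" "k - 1 \<le> card VH" using VH by auto
  then obtain S where S: "?T \<subseteq> S" "S \<subseteq> VH" "card S = k - 1"
    using VH exists_subset_between[of ?T "k - 1" VH] by auto
  have fin: "finite S" "finite (VH - S)" using S VH finite_subset by auto
  \<comment> \<open>The product over the complement of \<open>S\<close> vanishes, so one of its
    factors does; this \<open>w\<close> is the vertex not dominated by \<open>S\<close>.\<close>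
  obtain w where w: "w \<in> VH - S" "(\<Sum>v\<in>S. \<eta> v w) = 0"
    using min[OF S(2,3)] fin by auto
  then have "\<xi> w \<noteq> 1" using S by auto
  then obtain h' where h': "h' \<in> VH" "\<eta> w h' * \<xi> h' = 1"
    using dom[of w] w VH by auto
  then have "\<xi> h' = 1" "\<eta> w h' = 1" using bool(1)[of w h'] bool(2)[of h'] by auto
  then have "h' \<in> S" "\<eta> h' w = 1" using h' S sym by auto
  \<comment> \<open>Nonnegative terms with sum 0 all vanish, contradicting the term 1 at
    \<open>h'\<close>.\<close>
  moreover have "\<eta> v w \<ge> 0" for v using bool(1)[of v w] by auto
  ultimately show False using w fin by (simp add: sum_nonneg_eq_0_iff)
qed

lemma sum_boolean_eq_card:
  fixes \<xi> :: "'b \<Rightarrow> real"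
  assumes "finite V" "\<And>h. \<xi> h \<in> {0, 1}"
  shows "(\<Sum>h\<in>V. \<xi> h) = card {h \<in> V. \<xi> h = 1}"
proof -
  have "(\<Sum>h\<in>V. \<xi> h) = (\<Sum>h\<in>{h \<in> V. \<xi> h = 1}. \<xi> h)"
    using assms by (intro sum.mono_neutral_right) auto
  then show ?thesis by simp
qed

text \<open>Each product is the indicator of the pair lying in the set of ones, so the sum counts
  the pairs of ones.\<close>

lemma sum_pairs_boolean_eq_choose:
  fixes \<xi> :: "'b \<Rightarrow> real"
  assumes "finite V" "\<And>h. \<xi> h \<in> {0, 1}"
  shows "(\<Sum>T\<in>{T. T \<subseteq> V \<and> card T = 2}. \<Prod>h\<in>T. \<xi> h) = card {h \<in> V. \<xi> h = 1} choose 2"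
proof -
  let ?X = "{h \<in> V. \<xi> h = 1}"
  have "(\<Sum>T\<in>{T. T \<subseteq> V \<and> card T = 2}. \<Prod>h\<in>T. \<xi> h) =
      (\<Sum>T\<in>{T. T \<subseteq> ?X \<and> card T = 2}. \<Prod>h\<in>T. \<xi> h)"
  proof (rule sum.mono_neutral_right)
    show "\<forall>T\<in>{T. T \<subseteq> V \<and> card T = 2} - {T. T \<subseteq> ?X \<and> card T = 2}. (\<Prod>h\<in>T. \<xi> h) = 0"
    proof
      fix T assume T: "T \<in> {T. T \<subseteq> V \<and> card T = 2} - {T. T \<subseteq> ?X \<and> card T = 2}"
      then obtain h where "h \<in> T" "\<xi> h = 0" using assms by blast
      moreover have "finite T" using T assms finite_subset by blast
      ultimately show "(\<Prod>h\<in>T. \<xi> h) = 0" by (meson prod_zero)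
    qed
  qed (use assms in auto)
  also have "\<dots> = (\<Sum>T\<in>{T. T \<subseteq> ?X \<and> card T = 2}. 1)"
    by (intro sum.cong prod.neutral) auto
  also have "\<dots> = card ?X choose 2"
    using assms n_subsets[of ?X 2] by simp
  finally show ?thesis .
qed

text \<open>As a function of \<open>t\<close> the base of the square is the quadratic with values 0,
  -1, sqrt 2 at n - 2, n - 1, n, and the squares 0, 1, 2 are the required values. Its second
  difference is \<gamma>, the first difference -1 at n - 2 then fixes \<beta>, and the zero at n - 2
  fixes \<alpha>.\<close>

lemma certificate_value:
  fixes n t :: nat and \<alpha> \<beta> \<gamma> :: real
  assumes "n \<ge> 3" "n - 2 \<le> t" "t \<le> n"
    and \<alpha>: "\<alpha> = (real n - 2) * (real n + 1 / 2 * (real n - 1) * sqrt 2)"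
    and \<beta>: "\<beta> = - ((2 * real n - 3) + (real n - 2) * sqrt 2)"
    and \<gamma>: "\<gamma> = 2 + sqrt 2"
  shows "(\<alpha> + \<beta> * real t + \<gamma> * real (t choose 2))\<^sup>2 = real t - (real n - 2)"
proof -
  \<comment> \<open>\<open>choose_two\<close> divides in the naturals; parity makes the division
    exact before passing to the reals.\<close>
  have "even (t * (t - 1))" by (cases t) auto
  then have "2 * (t choose 2) = t * (t - 1)"
    by (simp add: choose_two)
  then have "2 * real (t choose 2) = real t * real (t - 1)"
    by (metis of_nat_mult of_nat_numeral)
  \<comment> \<open>The hypotheses give \<open>t\<close> at least 1, so the natural subtraction does
    not truncate.\<close>
  moreover have "real (t - 1) = real t - 1"
    using assms by (simp add: of_nat_diff)
  ultimately have c: "real (t choose 2) = real t * (real t - 1) / 2" by simp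
  have "t = n - 2 \<or> t = n - 1 \<or> t = n" using assms by arith
  then consider "real t = real n - 2" | "real t = real n - 1" | "real t = real n"
    using assms by (auto simp: of_nat_diff)
  then show ?thesis
  proof cases
    case 1
    have "\<alpha> + \<beta> * real t + \<gamma> * real (t choose 2) = 0"
      unfolding c 1 \<alpha> \<beta> \<gamma>
      by (simp add: algebra_simps add_divide_distrib diff_divide_distrib)
    then show ?thesis using 1 by simp
  next
    case 2
    have "\<alpha> + \<beta> * real t + \<gamma> * real (t choose 2) = - 1"
      unfolding c 2 \<alpha> \<beta> \<gamma>
      by (simp add: algebra_simps add_divide_distrib diff_divide_distrib)
    then show ?thesis using 2 by simp
  next
    case 3
    have "\<alpha> + \<beta> * real t + \<gamma> * real (t choose 2) = sqrt 2"
      unfolding c 3 \<alpha> \<beta> \<gamma>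
      by (simp add: algebra_simps add_divide_distrib diff_divide_distrib)
    then show ?thesis using 3 by simp
  qed
qed

section \<open>Domination numbers\<close>

lemma finite_dominating_sets: "finite V \<Longrightarrow> finite {D. dominating_set V E D}"
  by (rule finite_subset[of _ "Pow V"]) (auto simp: dominating_set_def)

lemma domination_number_le: "finite V \<Longrightarrow> dominating_set V E D \<Longrightarrow> domination_number V E \<le> card D"
  unfolding domination_number_def by (intro Min_le) (auto simp: finite_dominating_sets)

lemma domination_number_attained:
  assumes "finite V"
  obtains D where "dominating_set V E D" "card D = domination_number V E"
proof -
  have "dominating_set V E V" by (simp add: dominating_set_def)
  then have "domination_number V E \<in> card ` {D. dominating_set V E D}"
    unfolding domination_number_def
    by (intro Min_in finite_imageI finite_dominating_sets[OF assms]) auto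
  then show ?thesis using that by auto
qed

lemma domination_number_eq_card_imp_edgeless:
  assumes "simple_graph V E" "domination_number V E = card V"
  shows "E = {}"
proof (rule ccontr)
  assume "E \<noteq> {}"
  then obtain e where e: "e \<in> E" by auto
  then have "e \<subseteq> V" "card e = 2" using assms by (auto simp: simple_graph_def)
  then obtain v w where vw: "e = {v, w}" "v \<noteq> w" "v \<in> V" "w \<in> V" by (auto simp: card_2_iff)
  then have "dominating_set V E (V - {v})" using e by (auto simp: dominating_set_def)
  moreover have "finite V" using assms by (simp add: simple_graph_def)
  ultimately have "domination_number V E \<le> card (V - {v})" by (intro domination_number_le)
  then show False using assms(2) vw \<open>finite V\<close> card_Diff1_less[of V v] by simp
qed

text \<open>Without edges in the first factor the product is a disjoint union of copies of the
  second graph, and a dominating set must dominate each copy separately.\<close>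

lemma domination_number_edgeless_box:
  assumes "finite V1" "finite V2"
  shows "card V1 * domination_number V2 E2 \<le> domination_number (V1 \<times> V2) (box_edges V1 {} V2 E2)"
proof -
  obtain D where D: "dominating_set (V1 \<times> V2) (box_edges V1 {} V2 E2) D"
    "card D = domination_number (V1 \<times> V2) (box_edges V1 {} V2 E2)"
    using domination_number_attained[of "V1 \<times> V2"] assms by blast
  let ?F = "\<lambda>g. {h. (g, h) \<in> D}"
  have sub: "D \<subseteq> V1 \<times> V2" using D by (simp add: dominating_set_def)
  have fin: "finite (?F g)" for g
    by (rule finite_subset[OF _ assms(2)]) (use sub in auto)
  have "dominating_set V2 E2 (?F g)" if g: "g \<in> V1" for g
    unfolding dominating_set_def
  proof (intro conjI ballI)
    show "?F g \<subseteq> V2" using sub by auto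
    fix h assume h: "h \<in> V2 - ?F g"
    \<comment> \<open>An edge leaving the fibre over \<open>g\<close> would need an edge of the
      first graph, so \<open>d\<close> lies in the same fibre.\<close>
    then obtain d where "d \<in> D" "{(g, h), d} \<in> box_edges V1 {} V2 E2"
      using D g unfolding dominating_set_def by blast
    then show "\<exists>d\<in>?F g. {h, d} \<in> E2"
      by (auto simp: box_edges_def doubleton_eq_iff insert_commute)
  qed
  then have "(\<Sum>g\<in>V1. domination_number V2 E2) \<le> (\<Sum>g\<in>V1. card (?F g))"
    using assms by (intro sum_mono domination_number_le)
  also have "\<dots> = card (SIGMA g:V1. ?F g)"
    using assms fin by (intro card_SigmaI[symmetric]) auto
  also have "(SIGMA g:V1. ?F g) = D" using sub by auto
  finally show ?thesis using D by simp
qed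


section \<open>The certificate and the inequality for domination numbers\<close>

theorem theorem5p13:
  fixes K :: "real set"
    and VG DG :: "'a set" and VH DH :: "'b set"
    and nG kG nH kH :: nat
    and \<alpha> \<beta> \<gamma> :: real
    and s :: "'a \<Rightarrow> ('a, 'b) viz_var mpoly"
  assumes K: "subfield K (ring_of_type_algebra :: real ring)" and sqrt2: "sqrt 2 \<in> K"
    and VG: "finite VG" "card VG = nG" and DG: "DG \<subseteq> VG" "card DG = kG"
    and VH: "finite VH" "card VH = nH" and DH: "DH \<subseteq> VH" "card DH = kH"
    and kG: "kG = nG" "nG \<ge> 1"
    and kH: "kH = nH - 2" "nH - 2 \<ge> 1"
    and \<alpha>: "\<alpha> = (real nH - 2) * (real nH + 1 / 2 * (real nH - 1) * sqrt 2)"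
    and \<beta>: "\<beta> = - ((2 * real nH - 3) + (real nH - 2) * sqrt 2)"
    and \<gamma>: "\<gamma> = 2 + sqrt 2"
    and s: "\<And>g. g \<in> VG \<Longrightarrow>
      s g = mconst \<alpha> + mconst \<beta> * (\<Sum>h\<in>VH. xv g h)
          + mconst \<gamma> * (\<Sum>T\<in>{T. T \<subseteq> VH \<and> card T = 2}. \<Prod>h\<in>T. xv g h)"
  shows "sos_certificate (viz_ring K VG VH) (viz_ideal K VG DG kG VH DH kH) 2
           (viz_poly VG kG VH kH) VG s
       \<and> (\<forall>(V1 :: 'c set) E1 (V2 :: 'd set) E2.
            simple_graph V1 E1 \<and> card V1 = nG \<and> domination_number V1 E1 = nG \<and>
            simple_graph V2 E2 \<and> card V2 = nH \<and> domination_number V2 E2 = nH - 2 \<longrightarrow>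
            domination_number V1 E1 * domination_number V2 E2
              \<le> domination_number (V1 \<times> V2) (box_edges V1 E1 V2 E2))"
proof (intro conjI allI impI)
  let ?W = "viz_vars VG VH" and ?I = "viz_ideal K VG DG kG VH DH kH"
  let ?pairs = "{T. T \<subseteq> VH \<and> card T = 2}"
  let ?p = "viz_poly VG kG VH kH - (\<Sum>g\<in>VG. (s g)\<^sup>2)"
  interpret R: cring "poly_ring_over K ?W" by (rule cring_poly_ring_over[OF K])
  have gen: "viz_generators VG DG kG VH DH kH \<subseteq> carrier (poly_ring_over K ?W)"
    using viz_generators_carrier[OF K DG(1) DH(1)] by (simp add: viz_ring_def)
  interpret I: poly_ideal K ?W ?I
    unfolding poly_ideal_def viz_ideal_def viz_ring_def using K R.genideal_ideal[OF gen] by simp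
  have gen_I: "viz_generators VG DG kG VH DH kH \<subseteq> ?I"
    unfolding viz_ideal_def viz_ring_def by (rule R.genideal_self[OF gen])
  note K_simps = subfield_realD[OF K] subfield_real_of_nat[OF K] sqrt2
  \<comment> \<open>\<open>kH\<close> uses natural subtraction, the coefficients real subtraction;
    they agree because \<open>nH - 2\<close> is positive.\<close>
  have n: "nH \<ge> 3" "real (nH - 2) = real nH - 2" using kH by (auto simp: of_nat_diff)
  have K_diff: "x - y \<in> K" if "x \<in> K" "y \<in> K" for x y
    using subfield_realD(3)[OF K _ subfield_realD(5)[OF K], of x y] that by simp
  have K_num: "numeral m \<in> K" for m :: num
    using subfield_real_of_nat[OF K, of "numeral m"] by simp
  have half: "1 / 2 \<in> K" using subfield_real_inverse[OF K K_num] by (simp add: inverse_eq_divide)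
  \<comment> \<open>Here sqrt 2 in \<open>K\<close> enters: it places the coefficients, hence the
    polynomials \<open>s g\<close>, over \<open>K\<close>.\<close>
  have coeffs: "\<alpha> \<in> K" "\<beta> \<in> K" "\<gamma> \<in> K"
    unfolding \<alpha> \<beta> \<gamma> by (intro K_simps K_diff K_num half)+
  have vert: "Vert g h \<in> ?W" if "g \<in> VG" "h \<in> VH" for g h
    using that by (auto simp: viz_vars_def)
  have edgeG: "EdgeG {g, g'} \<in> ?W" if "g \<in> VG" "g' \<in> VG" "g \<noteq> g'" for g g'
    using that by (auto simp: viz_vars_def)
  have edgeH: "EdgeH {h, h'} \<in> ?W" if "h \<in> VH" "h' \<in> VH" "h \<noteq> h'" for h h'
    using that by (auto simp: viz_vars_def)
  have xv: "xv g h \<in> carrier (poly_ring_over K ?W)" if "g \<in> VG" "h \<in> VH" for g h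
    unfolding xv_def using vert that by (intro carrier_var[OF K])
  have s_carrier: "s g \<in> carrier (poly_ring_over K ?W)" if "g \<in> VG" for g
    unfolding s[OF that] using that
    by (intro carrier_add[OF K] carrier_mult[OF K] carrier_const[OF K] carrier_sum[OF K]
        carrier_prod[OF K] coeffs xv) auto
  have degree: "total_degree (s g) \<le> 2" if "g \<in> VG" for g
  proof -
    \<comment> \<open>The bound 1 serves the products of two variables, the bound 2 the linear sum,
      whose summands need the common final bound.\<close>
    have x: "total_degree (xv g h) \<le> 1" "total_degree (xv g h) \<le> 2" for h :: 'b
      by (simp_all add: xv_def total_degree_mvar)
    have scale: "total_degree (mconst c * q) \<le> 2" if "total_degree q \<le> 2"
      for c and q :: "('a, 'b) viz_var mpoly"
      using total_degree_mult_le[of "mconst c" 0 q 2] that by (simp add: total_degree_mconst)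
    have "total_degree (\<Prod>h\<in>T. xv g h) \<le> 2" if "T \<in> ?pairs" for T
      using total_degree_prod_le[of T "xv g"] x that by simp
    then show ?thesis
      unfolding s[OF that] using x
      by (intro total_degree_add_le scale total_degree_sum_le)
        (auto simp: total_degree_mconst)
  qed
  have p_carrier: "?p \<in> carrier (poly_ring_over K ?W)"
    unfolding viz_poly_def power2_eq_square mconst_of_nat[symmetric]
    by (intro carrier_diff[OF K] carrier_sum[OF K] carrier_mult[OF K] carrier_const[OF K]
        xv s_carrier K_simps)
  have fin_W: "finite ?W"
  proof -
    have "{Vert g h | g h. g \<in> VG \<and> h \<in> VH} = (\<lambda>(g, h). Vert g h) ` (VG \<times> VH)" by auto
    then show ?thesis using VG VH unfolding viz_vars_def by simp
  qed
  have bool_gen: "(mvar v)\<^sup>2 - mvar v \<in> ?I" if v: "v \<in> ?W" for v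
  proof -
    consider g g' where "v = EdgeG {g, g'}" "g \<in> VG" "g' \<in> VG" "g \<noteq> g'"
      | h h' where "v = EdgeH {h, h'}" "h \<in> VH" "h' \<in> VH" "h \<noteq> h'"
      | g h where "v = Vert g h" "g \<in> VG" "h \<in> VH"
      using v by (auto simp: viz_vars_def card_2_iff)
    then have "(mvar v)\<^sup>2 - mvar v \<in> viz_generators VG DG kG VH DH kH"
      unfolding viz_generators_def graph_generators_def product_generators_def
        eG_def eH_def xv_def by cases blast+
    then show ?thesis using gen_I by blast
  qed
  have "?p \<in> ?I"
  proof (rule ccontr)
    assume "?p \<notin> ?I"
    have "\<exists>J. poly_ideal K ?W J \<and> ?I \<subseteq> J \<and> ?p \<notin> J \<and> (\<forall>v\<in>mvar ` ?W. v \<in> J \<or> v - 1 \<in> J)"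
    proof (rule I.exists_boolean_ideal[OF _ _ _ p_carrier \<open>?p \<notin> ?I\<close>])
      show "mvar ` ?W \<subseteq> carrier (poly_ring_over K ?W)"
        by (intro image_subsetI carrier_var[OF K])
      show "v\<^sup>2 - v \<in> ?I" if "v \<in> mvar ` ?W" for v
        using that by (elim imageE) (simp only: bool_gen)
    qed (use fin_W in simp)
    then obtain J where J: "poly_ideal K ?W J" "?I \<subseteq> J" "?p \<notin> J"
      "\<forall>v\<in>mvar ` ?W. v \<in> J \<or> v - 1 \<in> J"
      by (elim exE conjE)
    interpret J: poly_ideal K ?W J by (rule J(1))
    note cong = J.cong_const_diff J.cong_const_mult J.cong_const_add J.cong_const_sum
      J.cong_const_prod J.cong_const_1
    \<comment> \<open>An ideal containing 1 would contain \<open>?p\<close>.\<close>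
    have 1: "1 \<notin> J" using J.mult_mem[OF p_carrier, of 1] J(3) by auto
    have gen_zero: "c = 0" if "J.cong_const q c" "q \<in> viz_generators VG DG kG VH DH kH" for q c
      using J.cong_const_eq_0[OF that(1) _ 1] that(2) gen_I J(2) by blast
    \<comment> \<open>The 0/1 point belonging to \<open>J\<close>; by \<open>gen_zero\<close> every
      generator vanishes there.\<close>
    obtain a where a: "\<And>v. a v \<in> {0, 1}" "\<And>v. v \<in> ?W \<Longrightarrow> J.cong_const (mvar v) (a v)"
      by (rule J.boolean_values) (use J(4) in auto)
    have x: "J.cong_const (xv g h) (a (Vert g h))" if "g \<in> VG" "h \<in> VH" for g h
      unfolding xv_def using a(2) vert that by blast
    have eG: "J.cong_const (eG g g') (a (EdgeG {g, g'}))" if "g \<in> VG" "g' \<in> VG" "g \<noteq> g'" for g g'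
      unfolding eG_def using a(2) edgeG that by blast
    have eH: "J.cong_const (eH h h') (a (EdgeH {h, h'}))" if "h \<in> VH" "h' \<in> VH" "h \<noteq> h'" for h h'
      unfolding eH_def using a(2) edgeH that by blast
    have G_edgeless: "a (EdgeG {g, g'}) = 0" if "g \<in> VG" "g' \<in> VG" "g \<noteq> g'" for g g'
    proof -
      \<comment> \<open>As \<open>kG\<close> is the number of all vertices, a set of size
        \<open>kG - 1\<close> omits exactly one vertex. The corresponding generator is the sum of
        all edge variables at \<open>g'\<close>.\<close>
      let ?S = "VG - {g'}"
      have S: "?S \<subseteq> VG" "card ?S = kG - 1" "VG - ?S = {g'}" using that VG kG by auto
      have "(\<Prod>w\<in>VG - ?S. \<Sum>v\<in>?S. eG v w) \<in> viz_generators VG DG kG VH DH kH"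
        unfolding viz_generators_def graph_generators_def using S(1,2) by blast
      moreover have "J.cong_const (\<Prod>w\<in>VG - ?S. \<Sum>v\<in>?S. eG v w)
          (\<Prod>w\<in>VG - ?S. \<Sum>v\<in>?S. a (EdgeG {v, w}))"
        by (intro cong eG) auto
      ultimately have "(\<Sum>v\<in>?S. a (EdgeG {v, g'})) = 0"
        using gen_zero[of "\<Prod>w\<in>VG - ?S. \<Sum>v\<in>?S. eG v w"] S(3) by simp
      moreover have "a v \<ge> 0" for v using a(1)[of v] by auto
      ultimately show ?thesis using that VG by (simp add: sum_nonneg_eq_0_iff)
    qed
    have X: "kH \<le> card {h \<in> VH. a (Vert g h) = 1}" if g: "g \<in> VG" for g
    proof (rule viz_values_fibre_card[of VH kH "\<lambda>h h'. a (EdgeH {h, h'})"])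
      show "(1 - a (Vert g h)) * (\<Prod>h'\<in>VH - {h}. 1 - a (EdgeH {h, h'}) * a (Vert g h')) = 0"
        if h: "h \<in> VH" for h
      proof -
        let ?q = "(1 - xv g h) * (\<Prod>g'\<in>VG - {g}. (1 - eG g g' * xv g' h))
          * (\<Prod>h'\<in>VH - {h}. (1 - eH h h' * xv g h'))"
        have q_value: "J.cong_const ?q
          ((1 - a (Vert g h)) * (\<Prod>g'\<in>VG - {g}. (1 - a (EdgeG {g, g'}) * a (Vert g' h)))
          * (\<Prod>h'\<in>VH - {h}. (1 - a (EdgeH {h, h'}) * a (Vert g h'))))"
          using g h by (intro cong x eG eH) auto
        have q_gen: "?q \<in> viz_generators VG DG kG VH DH kH"
          unfolding viz_generators_def product_generators_def using g h by blast
        \<comment> \<open>With no edges in the first graph, vertices of other fibres cannot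
          dominate, and the relation reduces to domination inside the fibre over
          \<open>g\<close>.\<close>
        have "(\<Prod>g'\<in>VG - {g}. (1 - a (EdgeG {g, g'}) * a (Vert g' h))) = 1"
          using G_edgeless[OF g] by (intro prod.neutral) auto
        then show ?thesis using gen_zero[OF q_value q_gen] by simp
      qed
      show "(\<Prod>w\<in>VH - S. \<Sum>v\<in>S. a (EdgeH {v, w})) = 0" if "S \<subseteq> VH" "card S = kH - 1" for S
      proof (rule gen_zero)
        show "J.cong_const (\<Prod>w\<in>VH - S. \<Sum>v\<in>S. eH v w) (\<Prod>w\<in>VH - S. \<Sum>v\<in>S. a (EdgeH {v, w}))"
          using that by (intro cong eH) auto
        show "(\<Prod>w\<in>VH - S. \<Sum>v\<in>S. eH v w) \<in> viz_generators VG DG kG VH DH kH"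
          unfolding viz_generators_def graph_generators_def using that by blast
      qed
    qed (use VH kH a(1) in \<open>simp_all add: insert_commute\<close>)
    define c where "c g = \<alpha> + \<beta> * (\<Sum>h\<in>VH. a (Vert g h))
      + \<gamma> * (\<Sum>T\<in>?pairs. \<Prod>h\<in>T. a (Vert g h))" for g
    have s_value: "J.cong_const (s g) (c g)" if "g \<in> VG" for g
      unfolding s[OF that] c_def using that
      by (intro cong J.cong_const_mconst coeffs x) auto
    have sq: "c g * c g = (\<Sum>h\<in>VH. a (Vert g h)) - real kH" if "g \<in> VG" for g
    proof -
      let ?X = "card {h \<in> VH. a (Vert g h) = 1}"
      have "nH - 2 \<le> ?X" "?X \<le> nH" using X[OF that] kH VH by (auto intro: card_mono)
      then have "(\<alpha> + \<beta> * real ?X + \<gamma> * real (?X choose 2))\<^sup>2 = real ?X - real kH"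
        using certificate_value[OF n(1) _ _ \<alpha> \<beta> \<gamma>] n kH by simp
      then show ?thesis
        unfolding c_def power2_eq_square
        by (simp add: sum_boolean_eq_card[OF VH(1) a(1)] sum_pairs_boolean_eq_choose[OF VH(1) a(1)])
    qed
    have "J.cong_const ?p
        ((\<Sum>g\<in>VG. \<Sum>h\<in>VH. a (Vert g h)) - of_nat (kG * kH) - (\<Sum>g\<in>VG. c g * c g))"
      unfolding viz_poly_def power2_eq_square mconst_of_nat[symmetric]
      by (intro cong J.cong_const_mconst x s_value subfield_real_of_nat[OF K])
    \<comment> \<open>Each fibre contributes its size minus \<open>kH\<close>. Summing subtracts
      \<open>kH\<close> once per vertex of \<open>VG\<close>, that is \<open>kG * kH\<close> in
      total since \<open>kG = nG\<close>.\<close>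
    moreover have "(\<Sum>g\<in>VG. \<Sum>h\<in>VH. a (Vert g h)) - of_nat (kG * kH) - (\<Sum>g\<in>VG. c g * c g) = 0"
      using VG kG by (simp add: sq sum_subtractf)
    ultimately show False using J(3) J.cong_const_0_mem by simp
  qed
  then show "sos_certificate (viz_ring K VG VH) ?I 2 (viz_poly VG kG VH kH) VG s"
    using VG s_carrier degree by (simp add: sos_certificate_def viz_ring_def)
next
  \<comment> \<open>The inequality is proved directly, not through the certificate: maximal
    domination number leaves the first graph without edges, and the fibrewise bound applies.\<close>
  fix V1 :: "'c set" and E1 and V2 :: "'d set" and E2
  assume *: "simple_graph V1 E1 \<and> card V1 = nG \<and> domination_number V1 E1 = nG \<and>
    simple_graph V2 E2 \<and> card V2 = nH \<and> domination_number V2 E2 = nH - 2"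
  then have "E1 = {}" using domination_number_eq_card_imp_edgeless by metis
  then show "domination_number V1 E1 * domination_number V2 E2
      \<le> domination_number (V1 \<times> V2) (box_edges V1 E1 V2 E2)"
    using * domination_number_edgeless_box[of V1 V2 E2] by (simp add: simple_graph_def)
qed

end
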